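(* Let $f\geq 1$ and $f'$ be positive integers such that $f$ divides $f'^2$ and $f'$ divides $f$. Then for every $k\in\mathbb{Z}$ we have $\gcd(1+kf',f)=1$, and $$s(1+kf',f)=\frac{f'^2}{12f}-\frac14+\frac{1}{6f}\quad\text{whenever }\gcd(k,f)=1.$$ In particular, if $p\geq 3$ is prime, $f=p^m$ and $1\leq n\leq m/2$, then $$s(1+kf/p^n,f)=\frac{f}{12p^{2n}}-\frac14+\frac{1}{6f}\quad\text{for } 1\leq k\leq p^n-1,\ \gcd(k,p)=1.$$ Therefore, for $m\geq 2$ and $1\leq n\leq m/2$, the Dedekind sum $s(h,p^m)$ takes the same value for all $h$ in the set of the $\phi(p^n)=p^{n-1}(p-1)$ elements of order $p^n$ of the multiplicative cyclic group $(\mathbb{Z}/p^m\mathbb{Z})^*$.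
   Context: For $d>1$ and $\gcd(c,d)=1$, the Dedekind sum is $s(c,d):=\frac{1}{4d}\sum_{a=1}^{d-1}\cot\left(\frac{\pi a}{d}\right)\cot\left(\frac{\pi a c}{d}\right)$ (depending only on $c$ modulo $d$), and $s(c,1):=0$ for all $c\in\mathbb{Z}$. *)

theory Defs
  imports
    "HOL-Analysis.Analysis"
    "HOL-Number_Theory.Number_Theory"
    "HOL-Algebra.Elementary_Groups"
begin

(* Meaningful for d \<ge> 1 and coprime c (int d); outside this range the value is an
   unused default of the total function. *)
definition dedekind_sum :: "int \<Rightarrow> nat \<Rightarrow> real" where
  "dedekind_sum c d =
    (if d = 1 then 0
     else 1 / (4 * real d) *
       (\<Sum>a = 1..d - 1. cot (pi * real a / real d) * cot (pi * real a * real_of_int c / real d)))"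

(* The multiplicative group of Z/dZ; its elements are the canonical representatives
   in {0..d - 1} of the residue classes coprime to d. *)
definition unit_group_mod :: "nat \<Rightarrow> int monoid" where
  "unit_group_mod d = units_of (residue_ring (int d))"

definition elements_of_order :: "('a, 'b) monoid_scheme \<Rightarrow> nat \<Rightarrow> 'a set" where
  "elements_of_order G r = {x \<in> carrier G. group.ord G x = r}"

end

(* Write C a = cot (pi a / n). For residues a, b, b - a nonzero modulo n the cotangent
   addition theorem reads C a * C b = C (b - a) * (C a - C b) - 1. Summing it over all pairs
   and using that C is odd gives the closed form of the sum of the squares of C.

   Put f = f' g, so that g divides f', and u = 1 + k f'. For x = pi a / f the two angles x and
   u x differ by pi a k / g, hence C a * C (u a) = D a * (C a - C (u a)) - 1 with
   D a = cot (pi a k / g), unless g divides a, in which case the product is (C a)^2.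
   As u = 1 modulo g, D a = D (u a), so the terms D a * C a and D (u a) * C (u a) cancel after
   reindexing by the bijection a -> u a of the residues modulo f. What remains is the number
   of a not divisible by g and a sum of squares of cotangents modulo f'.

   For an odd prime p with p dividing y - 1, raising y to the p-th power multiplies y - 1 by p
   up to a factor prime to p. Therefore the elements of order p^n modulo p^m are
   of the form 1 + k p^(m-n) with k prime to p, and the formula applies. *)
theory Submission
  imports Defs
begin

section \<open>Cotangents at rational multiples of pi\<close>

definition cot_frac :: "nat \<Rightarrow> int \<Rightarrow> real" where
  "cot_frac n a = cot (pi * of_int a / of_nat n)"

lemma sin_pi_frac_eq_0_iff:
  assumes "n > 0"
  shows "sin (pi * of_int a / of_nat n) = 0 \<longleftrightarrow> int n dvd a"
proof -
  have "pi * of_int a / of_nat n = of_int i * pi \<longleftrightarrow> a = int n * i" for i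
  proof -
    have "pi * of_int a / of_nat n = of_int i * pi \<longleftrightarrow> real_of_int a = of_int i * of_nat n"
      using assms by (simp add: field_simps)
    also have "\<dots> \<longleftrightarrow> real_of_int a = real_of_int (int n * i)"
      by (simp add: mult.commute)
    also have "\<dots> \<longleftrightarrow> a = int n * i"
      by (rule of_int_eq_iff)
    finally show ?thesis .
  qed
  then show ?thesis
    unfolding sin_zero_iff_int2 dvd_def by simp
qed

lemma cot_add_int_pi:
  fixes x :: real
  shows "cot (x + of_int i * pi) = cot x"
proof -
  have "sin (of_int i * pi) = 0"
    using sin_zero_iff_int2 by blast
  moreover have "cos (of_int i * pi) \<noteq> 0"
    using \<open>sin (of_int i * pi) = 0\<close> sin_cos_squared_add[of "of_int i * pi"] by auto
  ultimately show ?thesis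
    by (simp add: cot_def sin_add cos_add)
qed

text \<open>Division by zero makes \<open>cot\<close> vanish at its poles. Sums can therefore run
  over complete residue systems, where the multiples of \<open>n\<close> contribute nothing.\<close>

lemma cot_frac_dvd_eq_0:
  assumes "n > 0" "int n dvd a"
  shows "cot_frac n a = 0"
  using assms sin_pi_frac_eq_0_iff[of n a] by (simp add: cot_frac_def cot_def)

lemma cot_frac_minus [simp]: "cot_frac n (- a) = - cot_frac n a"
  by (simp add: cot_frac_def)

lemma cot_frac_cong:
  assumes "n > 0" "[a = b] (mod int n)"
  shows "cot_frac n a = cot_frac n b"
proof -
  obtain i where "a = b + int n * i"
    using assms(2) by (metis cong_iff_lin cong_sym)
  then have "pi * of_int a / of_nat n = pi * of_int b / of_nat n + of_int i * pi"
    using assms(1) by (simp add: field_simps)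
  then show ?thesis
    by (simp add: cot_frac_def cot_add_int_pi)
qed

text \<open>Dividing the addition formulas for \<open>sin (y - x)\<close> and
  \<open>cos (y - x)\<close> by \<open>sin x * sin y\<close> gives \<open>cot x - cot y\<close> and
  \<open>cot x * cot y + 1\<close>. The three hypotheses exclude the poles, where the default value
  0 breaks the identity.\<close>

lemma cot_mult_cot:
  fixes x y :: real
  assumes "sin x \<noteq> 0" "sin y \<noteq> 0" "sin (y - x) \<noteq> 0"
  shows "cot x * cot y = cot (y - x) * (cot x - cot y) - 1"
proof -
  have "cot x - cot y = sin (y - x) / (sin x * sin y)"
    using assms by (simp add: cot_def sin_diff field_simps)
  then have "cot (y - x) * (cot x - cot y) = cos (y - x) / (sin x * sin y)"
    using assms by (simp add: cot_def)
  also have "\<dots> = cot x * cot y + 1"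
    using assms by (simp add: cot_def cos_diff field_simps)
  finally show ?thesis by simp
qed

lemma cot_frac_mult:
  assumes "n > 0" "\<not> int n dvd a" "\<not> int n dvd b" "\<not> int n dvd b - a"
  shows "cot_frac n a * cot_frac n b = cot_frac n (b - a) * (cot_frac n a - cot_frac n b) - 1"
proof -
  have "pi * of_int (b - a) / of_nat n = pi * of_int b / of_nat n - pi * of_int a / of_nat n"
    by (simp add: diff_divide_distrib right_diff_distrib)
  with assms show ?thesis
    unfolding cot_frac_def
    by (metis cot_mult_cot sin_pi_frac_eq_0_iff)
qed

section \<open>Sums over a complete residue system\<close>

lemma sum_residues_reindex:
  fixes F :: "int \<Rightarrow> 'a::comm_monoid_add"
  assumes "n > 0"
    and F: "\<And>a b. [a = b] (mod int n) \<Longrightarrow> F a = F b"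
    and \<sigma>: "\<And>a b. [\<sigma> a = \<sigma> b] (mod int n) \<Longrightarrow> [a = b] (mod int n)"
  shows "(\<Sum>a\<in>{0..<int n}. F (\<sigma> a)) = (\<Sum>a\<in>{0..<int n}. F a)"
proof -
  \<comment> \<open>\<open>\<sigma>\<close> may leave the interval; reduced modulo \<open>n\<close>
    it is an injective self-map of a finite set, hence a permutation.\<close>
  let ?h = "\<lambda>a. \<sigma> a mod int n"
  have inj: "inj_on ?h {0..<int n}"
    using \<sigma> by (intro inj_onI) (metis atLeastLessThan_iff cong_def mod_pos_pos_trivial)
  have "?h ` {0..<int n} = {0..<int n}"
    using assms(1) by (intro card_subset_eq) (auto simp: card_image[OF inj])
  with inj have "bij_betw ?h {0..<int n} {0..<int n}"
    by (simp add: bij_betw_def)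
  then have "(\<Sum>a\<in>{0..<int n}. F (?h a)) = (\<Sum>a\<in>{0..<int n}. F a)"
    by (rule sum.reindex_bij_betw)
  moreover have "F (?h a) = F (\<sigma> a)" for a
    by (rule F) (simp add: cong_def)
  ultimately show ?thesis by simp
qed

text \<open>A translation permutes the residues, so the case \<open>a = 0\<close> suffices. There
  \<open>b \<mapsto> -b\<close> turns the sum into its own negative.\<close>

lemma sum_cot_frac_shift:
  assumes "n > 0"
  shows "(\<Sum>b\<in>{0..<int n}. cot_frac n (b - a)) = 0"
proof -
  have "(\<Sum>b\<in>{0..<int n}. cot_frac n (- b)) = (\<Sum>b\<in>{0..<int n}. cot_frac n b)"
    using assms by (intro sum_residues_reindex cot_frac_cong) (auto simp: cong_minus_minus_iff)
  then have "(\<Sum>b\<in>{0..<int n}. cot_frac n b) = 0"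
    by (simp add: sum_negf)
  moreover have "(\<Sum>b\<in>{0..<int n}. cot_frac n (b - a)) = (\<Sum>b\<in>{0..<int n}. cot_frac n b)"
    using assms
    by (intro sum_residues_reindex cot_frac_cong)
       (auto simp: cong_iff_dvd_diff)
  ultimately show ?thesis by simp
qed

text \<open>\<open>?T a b\<close> is the product minus the main term of the addition theorem: -1 for
  generic pairs, a square of a cotangent for degenerate ones. Its total is 0, and counting it by
  rows also gives \<open>3 * ?S - (n - 1) * (n - 2)\<close>.\<close>

lemma sum_cot_frac_squared:
  assumes "n > 0"
  shows "(\<Sum>a\<in>{0..<int n}. (cot_frac n a)\<^sup>2) = (real n - 1) * (real n - 2) / 3"
proof -
  let ?R = "{0..<int n}" and ?C = "cot_frac n"
  let ?S = "\<Sum>a\<in>?R. (?C a)\<^sup>2"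
  let ?T = "\<lambda>a b. ?C a * ?C b - ?C (b - a) * (?C a - ?C b)"
  have shift: "(\<Sum>b\<in>?R. ?C (b - a)) = 0" for a
    by (rule sum_cot_frac_shift[OF assms])
  have zero: "?C 0 = 0"
    by (simp add: cot_frac_def)
  have ndvd: "int n dvd c \<longleftrightarrow> c = 0" if "\<bar>c\<bar> < int n" for c
    using that zdvd_imp_le[of "int n" "\<bar>c\<bar>"] by fastforce
  \<comment> \<open>Since \<open>?C 0 = 0\<close>, the entry \<open>?T 0 b\<close> is the square of
    \<open>?C b\<close>.\<close>
  have row0: "(\<Sum>b\<in>?R. ?T 0 b) = ?S"
    by (simp add: zero power2_eq_square)
  have row: "(\<Sum>b\<in>?R. ?T a b) = 2 * (?C a)\<^sup>2 - (real n - 2)" if a: "a \<in> ?R - {0}" for a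
  proof -
    have 1: "?T a b = -1" if "b \<in> ?R - {0, a}" for b
    proof -
      have "\<not> int n dvd a" "\<not> int n dvd b" "\<not> int n dvd b - a"
        using a that ndvd[of a] ndvd[of b] ndvd[of "b - a"] by (auto simp: abs_if)
      from cot_frac_mult[OF assms this] show ?thesis
        by simp
    qed
    have "(\<Sum>b\<in>?R. ?T a b) = (\<Sum>b\<in>{0, a}. ?T a b) + (\<Sum>b\<in>?R - {0, a}. ?T a b)"
      using a assms by (subst add.commute, intro sum.subset_diff) auto
    also have "(\<Sum>b\<in>?R - {0, a}. ?T a b) = (\<Sum>b\<in>?R - {0, a}. -1)"
      using 1 by (intro sum.cong) auto
    also have "\<dots> = - (real n - 2)"
    proof -
      have "{0, a} \<subseteq> ?R" "card {0, a} = 2"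
        using a assms by auto
      moreover from this have "2 \<le> card ?R"
        using card_mono[of ?R "{0, a}"] by simp
      ultimately show ?thesis
        by (simp add: card_Diff_subset of_nat_diff)
    qed
    \<comment> \<open>Both exceptional columns give the square of \<open>?C a\<close>: for
      \<open>b = 0\<close> because \<open>?C\<close> is odd, for \<open>b = a\<close> because the
      difference \<open>?C a - ?C b\<close> vanishes.\<close>
    also have "(\<Sum>b\<in>{0, a}. ?T a b) = 2 * (?C a)\<^sup>2"
      using a by (simp add: zero power2_eq_square)
    finally show ?thesis by simp
  qed
  \<comment> \<open>Each of the three pieces contains a sum of \<open>?C\<close> over a translated
    residue system, which is 0; in the third it appears after exchanging the summations and using
    oddness.\<close>
  have "(\<Sum>a\<in>?R. \<Sum>b\<in>?R. ?T a b)
      = (\<Sum>a\<in>?R. ?C a * (\<Sum>b\<in>?R. ?C (b - 0))) - (\<Sum>a\<in>?R. ?C a * (\<Sum>b\<in>?R. ?C (b - a)))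
        + (\<Sum>a\<in>?R. \<Sum>b\<in>?R. ?C (b - a) * ?C b)"
    by (simp add: sum_subtractf sum.distrib sum_distrib_left algebra_simps)
  also have "(\<Sum>a\<in>?R. \<Sum>b\<in>?R. ?C (b - a) * ?C b) = (\<Sum>b\<in>?R. \<Sum>a\<in>?R. - (?C b * ?C (a - b)))"
    by (subst sum.swap, intro sum.cong refl)
       (metis cot_frac_minus minus_diff_eq mult.commute mult_minus_right)
  also have "\<dots> = - (\<Sum>b\<in>?R. ?C b * (\<Sum>a\<in>?R. ?C (a - b)))"
    by (simp add: sum_negf sum_distrib_left)
  finally have "(\<Sum>a\<in>?R. \<Sum>b\<in>?R. ?T a b) = 0"
    unfolding shift by simp
  moreover have "(\<Sum>a\<in>?R. \<Sum>b\<in>?R. ?T a b) = ?S + (\<Sum>a\<in>?R - {0}. 2 * (?C a)\<^sup>2 - (real n - 2))"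
    using assms row0 row by (subst sum.remove[of _ 0]) auto
  moreover have "(\<Sum>a\<in>?R - {0}. 2 * (?C a)\<^sup>2 - (real n - 2)) = 2 * ?S - (real n - 1) * (real n - 2)"
  proof -
    have "?S = (\<Sum>a\<in>?R - {0}. (?C a)\<^sup>2)"
      using assms by (subst sum.remove[of _ 0]) (auto simp: zero)
    moreover have "real (card (?R - {0})) = real n - 1"
      using assms by (simp add: of_nat_diff)
    ultimately show ?thesis
      by (simp add: sum_subtractf sum_distrib_left)
  qed
  ultimately show ?thesis by simp
qed

section \<open>Evaluation of the Dedekind sum at \<open>1 + k * f'\<close>\<close>

lemma dedekind_sum_eq_sum_residues:
  assumes "d > 0"
  shows "dedekind_sum c d = (\<Sum>a\<in>{0..<int d}. cot_frac d a * cot_frac d (c * a)) / (4 * real d)"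
proof -
  \<comment> \<open>The added index 0 contributes \<open>cot 0 = 0\<close>. For \<open>d = 1\<close>
    it is the only index, in agreement with the separate case of the definition.\<close>
  have "{0..<int d} = insert 0 (int ` {1..d - 1})"
  proof -
    have "{0..<int d} = int ` {0..<d}"
      by (simp add: image_int_atLeastLessThan)
    also have "{0..<d} = insert 0 {1..d - 1}"
      using assms by auto
    finally show ?thesis by simp
  qed
  moreover have "0 \<notin> int ` {1..d - 1}"
    by auto
  ultimately have "(\<Sum>a\<in>{0..<int d}. cot_frac d a * cot_frac d (c * a))
           = (\<Sum>a\<in>int ` {1..d - 1}. cot_frac d a * cot_frac d (c * a))"
    by (simp add: cot_frac_def)
  also have "\<dots> = (\<Sum>a = 1..d - 1. cot_frac d (int a) * cot_frac d (c * int a))"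
    by (simp add: sum.reindex)
  also have "\<dots> = (\<Sum>a = 1..d - 1. cot (pi * real a / real d) * cot (pi * real a * real_of_int c / real d))"
    by (simp add: cot_frac_def mult_ac)
  finally show ?thesis
    by (auto simp: dedekind_sum_def)
qed

text \<open>A number that is 1 modulo \<open>f'\<close> is coprime to \<open>f'\<close>, hence to
  its square and to every divisor of that square.\<close>

lemma coprime_one_plus_mult:
  fixes k f f' :: int
  assumes "f dvd f'\<^sup>2"
  shows "coprime (1 + k * f') f"
proof -
  have "coprime (1 + k * f') f'"
    by (metis add.commute coprime_1_left coprime_commute gcd_add_mult coprime_iff_gcd_eq_1)
  then have "coprime (1 + k * f') (f'\<^sup>2)"
    by simp
  with assms show ?thesis
    by (meson coprime_divisors dvd_refl)
qed

lemma dedekind_sum_one_plus_mult: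
  fixes f f' :: nat and k :: int
  assumes f: "f > 0" and sq: "f dvd f'\<^sup>2" and dvd: "f' dvd f" and k: "coprime k (int f)"
  shows "dedekind_sum (1 + k * int f') f = (real f')\<^sup>2 / (12 * real f) - 1 / 4 + 1 / (6 * real f)"
proof -
  obtain g where g: "f = f' * g"
    using dvd by (elim dvdE)
  have pos: "f' > 0" "g > 0"
    using f g by auto
  \<comment> \<open>With \<open>f = f' * g\<close>, the hypothesis that \<open>f\<close> divides the
    square of \<open>f'\<close> says exactly this. It makes \<open>u\<close> equal to 1 modulo
    \<open>g\<close>.\<close>
  have gf': "g dvd f'"
    using sq pos by (simp add: g power2_eq_square)
  have kg: "coprime k (int g)"
    using k by (simp add: g)
  define u where "u = 1 + k * int f'"
  have u: "coprime u (int f)"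
    unfolding u_def using sq by (intro coprime_one_plus_mult) (metis of_nat_dvd_iff of_nat_power)
  have ug: "[u * a = a] (mod int g)" for a
  proof -
    have "int g dvd u * a - a"
      using gf' by (simp add: u_def algebra_simps)
    then show ?thesis
      by (simp add: cong_iff_dvd_diff)
  qed
  let ?R = "{0..<int f}" and ?C = "cot_frac f"
  define D where "D a = cot_frac g (k * a)" for a
  have D_cong: "D a = D b" if "[a = b] (mod int g)" for a b
    unfolding D_def using that pos by (intro cot_frac_cong cong_scalar_left)
  have C_cong: "?C a = ?C b" if "[a = b] (mod int f)" for a b
    using that f by (rule cot_frac_cong[rotated])
  have angle: "pi * of_int (u * a - a) / of_nat f = pi * of_int (k * a) / of_nat g" for a
    using pos by (simp add: u_def g field_simps)
  have pointwise: "?C a * ?C (u * a) = D a * ?C a - D (u * a) * ?C (u * a)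
      + (if int g dvd a then (?C a)\<^sup>2 else -1)" for a
  proof (cases "int g dvd a")
    case True
    then have "D a = 0"
      by (auto simp: D_def intro!: cot_frac_dvd_eq_0 pos)
    moreover have "?C (u * a) = ?C a"
    proof (rule C_cong)
      have "int f dvd k * int f' * a"
        using True by (auto simp: g)
      then show "[u * a = a] (mod int f)"
        by (simp add: cong_iff_dvd_diff u_def algebra_simps)
    qed
    ultimately show ?thesis
      using True D_cong[OF ug[of a]] by (simp add: power2_eq_square)
  next
    case False
    have "\<not> int g dvd k * a"
      using False kg by (metis coprime_commute coprime_dvd_mult_right_iff)
    \<comment> \<open>By \<open>angle\<close> both divisibility conditions express that the sine of
      the same angle vanishes.\<close>
    then have 1: "\<not> int f dvd u * a - a"
      using sin_pi_frac_eq_0_iff[OF f, of "u * a - a"] sin_pi_frac_eq_0_iff[OF pos(2), of "k * a"]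
      unfolding angle by blast
    have 2: "\<not> int f dvd a"
      using False by (auto simp: g dest: dvd_mult_right)
    then have 3: "\<not> int f dvd u * a"
      using u by (metis coprime_commute coprime_dvd_mult_right_iff)
    have "?C (u * a - a) = D a"
      unfolding D_def cot_frac_def angle ..
    then show ?thesis
      using cot_frac_mult[OF f 2 3 1] False D_cong[OF ug[of a]] by (simp add: algebra_simps)
  qed
  have "(\<Sum>a\<in>?R. D (u * a) * ?C (u * a)) = (\<Sum>a\<in>?R. D a * ?C a)"
  proof (rule sum_residues_reindex[OF f])
    fix a b assume ab: "[a = b] (mod int f)"
    then have "[a = b] (mod int g)"
      by (rule cong_dvd_modulus) (simp add: g)
    then show "D a * ?C a = D b * ?C b"
      using C_cong[OF ab] D_cong by simp
  next
    fix a b assume "[u * a = u * b] (mod int f)"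
    then show "[a = b] (mod int f)"
      using u by (simp add: cong_mult_lcancel)
  qed
  then have "(\<Sum>a\<in>?R. ?C a * ?C (u * a)) = (\<Sum>a\<in>?R. if int g dvd a then (?C a)\<^sup>2 else -1)"
    by (simp only: pointwise sum.distrib sum_subtractf)
  also have "\<dots> = (\<Sum>a\<in>{a\<in>?R. int g dvd a}. (?C a)\<^sup>2) - real (card {a\<in>?R. \<not> int g dvd a})"
    by (simp add: sum.If_cases Int_def)
  also have "\<dots> = (real f' - 1) * (real f' - 2) / 3 - (real f - real f')"
  proof -
    \<comment> \<open>The multiples of \<open>g\<close> below \<open>f\<close> are
      \<open>g * b\<close> with \<open>b < f'\<close>, and \<open>g * b / f = b / f'\<close>, so
      their squares sum to the closed form for \<open>f'\<close>.\<close>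
    have mult: "{a\<in>?R. int g dvd a} = (\<lambda>b. int g * b) ` {0..<int f'}"
      using pos by (auto simp: g mult.commute zero_le_mult_iff)
    have inj: "inj_on (\<lambda>b. int g * b) {0..<int f'}"
      using pos by (auto intro: inj_onI)
    have "(\<Sum>a\<in>{a\<in>?R. int g dvd a}. (?C a)\<^sup>2) = (\<Sum>b\<in>{0..<int f'}. (cot_frac f' b)\<^sup>2)"
      unfolding mult sum.reindex[OF inj] using pos by (auto simp: cot_frac_def g field_simps)
    moreover have "{a\<in>?R. \<not> int g dvd a} = ?R - {a\<in>?R. int g dvd a}"
      by auto
    moreover have "card (?R - {a\<in>?R. int g dvd a}) = f - f'"
    proof (subst card_Diff_subset)
      show "card ?R - card {a\<in>?R. int g dvd a} = f - f'"
        unfolding mult by (simp add: card_image[OF inj])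
      show "finite {a\<in>?R. int g dvd a}"
        unfolding mult by simp
    qed auto
    moreover have "f' \<le> f"
      using dvd f by (rule dvd_imp_le)
    ultimately show ?thesis
      by (simp only: sum_cot_frac_squared[OF pos(1)] of_nat_diff)
  qed
  finally have "(\<Sum>a\<in>?R. ?C a * ?C (u * a)) = (real f' - 1) * (real f' - 2) / 3 - (real f - real f')" .
  \<comment> \<open>The right-hand side simplifies to \<open>(f'^2 + 2) / 3 - f\<close>; dividing by
    \<open>4 * f\<close> gives the three terms of the claim.\<close>
  then show ?thesis
    unfolding u_def[symmetric] dedekind_sum_eq_sum_residues[OF f] using f
    by (simp add: field_simps power2_eq_square)
qed

section \<open>Powers of integers congruent to 1 modulo an odd prime\<close>

lemma one_plus_power_cong:
  fixes x :: int
  shows "[(1 + x) ^ i = 1 + of_nat i * x] (mod x\<^sup>2)"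
proof (induction i)
  case (Suc i)
  have "[(1 + x) * (1 + x) ^ i = (1 + x) * (1 + of_nat i * x)] (mod x\<^sup>2)"
    using Suc by (rule cong_scalar_left)
  also have "(1 + x) * (1 + of_nat i * x) = 1 + of_nat (Suc i) * x + x\<^sup>2 * of_nat i"
    by (simp add: algebra_simps power2_eq_square)
  also have "[\<dots> = 1 + of_nat (Suc i) * x] (mod x\<^sup>2)"
    by (simp add: cong_iff_dvd_diff)
  finally show ?case by simp
qed simp

text \<open>The cofactor of \<open>y - 1\<close> is the geometric sum, which modulo
  \<open>p^2\<close> equals \<open>p + (y - 1) * p * (p - 1) / 2\<close>. As \<open>p\<close> is
  odd, \<open>(p - 1) / 2\<close> is an integer and the second term vanishes modulo
  \<open>p^2\<close>, so \<open>p\<close> divides the cofactor exactly once.\<close>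

lemma prime_power_minus_one_factor:
  fixes y :: int and p :: nat
  assumes p: "prime p" "odd p" and y: "int p dvd y - 1"
  obtains s where "coprime s (int p)" "y ^ p - 1 = (y - 1) * (int p * s)"
proof -
  let ?S = "\<Sum>i<p. y ^ i"
  obtain q where q: "p - 1 = 2 * q"
    using p(2) by (auto elim!: oddE)
  have "[y ^ i = 1 + of_nat i * (y - 1)] (mod (int p)\<^sup>2)" for i
    using one_plus_power_cong[of "y - 1" i] y
    by (auto intro: cong_dvd_modulus simp: dvd_power_same)
  then have "[?S = (\<Sum>i<p. 1 + of_nat i * (y - 1))] (mod (int p)\<^sup>2)"
    by (intro cong_sum)
  also have "(\<Sum>i<p. 1 + of_nat i * (y - 1)) = int p + int p * int q * (y - 1)"
  proof -
    have "(\<Sum>i<p. i) = p * q"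
      using q gauss_sum_nat[of "p - 1"] prime_gt_0_nat[OF p(1)]
      by (cases p) (simp_all add: lessThan_Suc_atMost atMost_atLeast0)
    moreover have "(\<Sum>i<p. int i) = int (\<Sum>i<p. i)"
      by simp
    ultimately have "(\<Sum>i<p. int i) = int p * int q"
      by (simp only: of_nat_mult)
    then show ?thesis
      by (simp add: sum.distrib flip: sum_distrib_right)
  qed
  also have "[\<dots> = int p] (mod (int p)\<^sup>2)"
    using y by (auto simp: cong_iff_dvd_diff power2_eq_square intro!: mult_dvd_mono)
  finally obtain r where r: "?S = int p + (int p)\<^sup>2 * r"
    by (metis cong_iff_lin cong_sym)
  show thesis
  proof
    show "coprime (1 + int p * r) (int p)"
      using coprime_one_plus_mult[of "int p" "int p" r] by (simp add: mult.commute power2_eq_square)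
    show "y ^ p - 1 = (y - 1) * (int p * (1 + int p * r))"
      using r by (simp add: power_diff_1_eq power2_eq_square algebra_simps)
  qed
qed

text \<open>Iterating the factorization gives \<open>y^(p^i) - 1 = (y - 1) * p^i * s\<close> with
  \<open>s\<close> coprime to \<open>p\<close>, and \<open>s\<close> does not affect divisibility by
  \<open>p^m\<close>.\<close>

lemma prime_power_dvd_power_minus_one_iff:
  fixes y :: int and p :: nat
  assumes p: "prime p" "odd p" and y: "int p dvd y - 1"
  shows "int p ^ m dvd y ^ (p ^ i) - 1 \<longleftrightarrow> int p ^ m dvd (y - 1) * int p ^ i"
proof -
  have "\<exists>s. coprime s (int p) \<and> y ^ (p ^ i) - 1 = (y - 1) * int p ^ i * s"
  proof (induction i)
    case 0
    show ?case by (intro exI[of _ 1]) simp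
  next
    case (Suc i)
    then obtain s where s: "coprime s (int p)" "y ^ (p ^ i) - 1 = (y - 1) * int p ^ i * s"
      by blast
    then have "int p dvd y ^ (p ^ i) - 1"
      using y by simp
    from prime_power_minus_one_factor[OF p this] obtain s'
      where "coprime s' (int p)" "(y ^ (p ^ i)) ^ p - 1 = (y ^ (p ^ i) - 1) * (int p * s')" .
    with s show ?case
      by (intro exI[of _ "s * s'"]) (simp flip: power_mult add: mult_ac)
  qed
  then obtain s where s: "coprime s (int p)" "y ^ (p ^ i) - 1 = (y - 1) * int p ^ i * s"
    by blast
  then have "coprime (int p ^ m) s"
    by (simp add: coprime_commute)
  then show ?thesis
    unfolding s(2) by (rule coprime_dvd_mult_left_iff)
qed

text \<open>This form of Fermat's theorem covers the multiples of \<open>p\<close> as well, so it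
  iterates to \<open>x^(p^i) = x\<close> modulo \<open>p\<close>.\<close>

lemma fermat_little_int:
  fixes x :: int
  assumes "prime p"
  shows "[x ^ p = x] (mod int p)"
proof -
  define a where "a = nat (x mod int p)"
  have x: "[x = int a] (mod int p)"
    using prime_gt_0_nat[OF assms] by (simp add: a_def)
  have "[a ^ p = a] (mod p)"
  proof (cases "p dvd a")
    case True
    moreover from this have "p dvd a ^ p"
      using prime_gt_0_nat[OF assms] by (meson dvd_power dvd_trans)
    ultimately show ?thesis
      by (simp add: cong_def mod_0_imp_dvd)
  next
    case False
    from cong_scalar_left[OF fermat_theorem[OF assms this], of a] show ?thesis
      using prime_gt_0_nat[OF assms] by (simp add: power_eq_if)
  qed
  then have "[int a ^ p = int a] (mod int p)"
    by (metis cong_int_iff of_nat_power)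
  with x show ?thesis
    by (metis cong_pow cong_sym cong_trans)
qed

text \<open>Modulo \<open>p\<close>, \<open>h\<close> equals \<open>h^(p^n)\<close>, which is 1, so
  the divisibility criterion applies to \<open>h - 1\<close>. The first congruence then yields the
  factor \<open>p^(m - n)\<close>; one more factor \<open>p\<close> would contradict
  \<open>not_one\<close>.\<close>

lemma order_prime_power_imp_one_plus_mult:
  fixes h :: int and p m n :: nat
  assumes p: "prime p" "odd p" and n: "1 \<le> n" "n < m"
    and one: "[h ^ (p ^ n) = 1] (mod int p ^ m)"
    and not_one: "\<not> [h ^ (p ^ (n - 1)) = 1] (mod int p ^ m)"
  obtains k where "h = 1 + k * int p ^ (m - n)" "coprime k (int p)"
proof -
  have "[h ^ (p ^ i) = h] (mod int p)" for i
  proof (induction i)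
    case (Suc i)
    from cong_trans[OF fermat_little_int[OF p(1), of "h ^ (p ^ i)"] Suc] show ?case
      by (simp flip: power_mult add: mult.commute)
  qed simp
  moreover have "[h ^ (p ^ n) = 1] (mod int p)"
    using one by (rule cong_dvd_modulus) (use n in auto)
  ultimately have "[h = 1] (mod int p)"
    by (metis cong_sym cong_trans)
  then have h: "int p dvd h - 1"
    by (simp add: cong_iff_dvd_diff)
  have "int p ^ (m - n) * int p ^ n dvd (h - 1) * int p ^ n"
    using one prime_power_dvd_power_minus_one_iff[OF p h, of m n] n
    by (simp add: cong_iff_dvd_diff flip: power_add)
  then obtain k where k: "h - 1 = int p ^ (m - n) * k"
    using prime_gt_0_nat[OF p(1)] by (auto elim: dvdE)
  have "\<not> int p dvd k"
  proof
    assume "int p dvd k"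
    then have "int p ^ (m - n) * int p * int p ^ (n - 1) dvd (h - 1) * int p ^ (n - 1)"
      unfolding k by (intro mult_dvd_mono) auto
    also have "int p ^ (m - n) * int p * int p ^ (n - 1) = int p ^ (m - n + 1 + (n - 1))"
      by (simp add: power_add)
    also have "m - n + 1 + (n - 1) = m"
      using n by simp
    finally show False
      using not_one prime_power_dvd_power_minus_one_iff[OF p h, of m "n - 1"]
      by (simp add: cong_iff_dvd_diff)
  qed
  then have "coprime k (int p)"
    using p(1) by (metis coprime_commute prime_imp_coprime prime_nat_int_transfer)
  moreover have "h = 1 + k * int p ^ (m - n)"
    using k by (simp add: algebra_simps)
  ultimately show thesis
    using that by blast
qed

section \<open>Elements of given order in a finite cyclic group\<close>

lemma (in group) card_elements_of_order_cyclic: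
  assumes cyclic: "cyclic_group G" and fin: "finite (carrier G)" and d: "d dvd order G"
  shows "card (elements_of_order G d) = totient d"
proof -
  let ?N = "order G"
  obtain x where x: "x \<in> carrier G" and gen: "subgroup_generated G {x} = G"
    using cyclic by (auto simp: cyclic_group_def)
  have ord_x: "ord x = ?N"
    using cyclic_order_is_ord[OF x] gen by simp
  have N: "?N > 0"
    using fin by (simp add: order_gt_0_iff_finite)
  have inj: "inj_on (\<lambda>k. x [^] k) {1..?N}"
    using ord_inj'[OF x] by (simp add: ord_x)
  have "(\<lambda>k. x [^] k) ` {1..?N} = carrier G"
  proof (rule card_subset_eq[OF fin])
    show "card ((\<lambda>k. x [^] k) ` {1..?N}) = card (carrier G)"
      unfolding card_image[OF inj] by (simp add: order_def)
  qed (use x in auto)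
  then have "elements_of_order G d = {y \<in> (\<lambda>k. x [^] k) ` {1..?N}. ord y = d}"
    by (simp add: elements_of_order_def)
  also have "\<dots> = (\<lambda>k. x [^] k) ` {k \<in> {1..?N}. ord (x [^] k) = d}"
    by blast
  \<comment> \<open>For a generator \<open>x\<close>, the order of the \<open>k\<close>-th power is
    \<open>?N div gcd ?N k\<close>. Exponents run from 1 to \<open>?N\<close> to match the range in
    \<open>card_gcd_eq_totient\<close>.\<close>
  also have "{k \<in> {1..?N}. ord (x [^] k) = d} = {k \<in> {0<..?N}. gcd k ?N = ?N div d}"
  proof -
    have "?N div gcd ?N k = d \<longleftrightarrow> gcd k ?N = ?N div d" for k
    proof -
      obtain e where e: "?N = gcd k ?N * e"
        by (rule dvdE[OF gcd_dvd2])
      obtain q where q: "?N = d * q"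
        using d by (rule dvdE)
      have "?N div gcd ?N k = e"
        using e N by (metis gcd.commute nonzero_mult_div_cancel_left mult_eq_0_iff not_gr_zero)
      moreover have "?N div d = q"
        using q N by (metis nonzero_mult_div_cancel_left mult_eq_0_iff not_gr_zero)
      moreover have "e = d \<longleftrightarrow> gcd k ?N = q"
        using e q N by (metis mult.commute mult_cancel_left not_gr_zero mult_eq_0_iff)
      ultimately show ?thesis by simp
    qed
    then show ?thesis
      by (auto simp: ord_pow_gen[OF x] ord_x)
  qed
  also have "card ((\<lambda>k. x [^] k) ` \<dots>) = totient (?N div (?N div d))"
  proof -
    have "inj_on (\<lambda>k. x [^] k) {k \<in> {0<..?N}. gcd k ?N = ?N div d}"
      using inj by (rule inj_on_subset) auto
    moreover have "?N div d dvd ?N"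
      using d by (metis dvd_div_mult_self dvd_triv_left)
    ultimately show ?thesis
      using N by (simp only: card_image card_gcd_eq_totient)
  qed
  also have "?N div (?N div d) = d"
  proof -
    obtain q where q: "?N = d * q"
      using d by (rule dvdE)
    with N have "d > 0" "q > 0"
      by auto
    then show ?thesis
      by (simp add: q)
  qed
  finally show ?thesis .
qed

section \<open>The unit group modulo \<open>d\<close>\<close>

lemma group_unit_group_mod:
  assumes "d > 1"
  shows "group (unit_group_mod d)"
proof -
  interpret residues "int d" "residue_ring (int d)"
    by unfold_locales (use assms in auto)
  show ?thesis
    unfolding unit_group_mod_def by (rule units_group)
qed

text \<open>Totatives lie between 1 and \<open>d\<close>, canonical residues between 0 and
  \<open>d - 1\<close>. For \<open>d > 1\<close> neither 0 nor \<open>d\<close> is coprime to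
  \<open>d\<close>, so the two sets match.\<close>

lemma carrier_unit_group_mod:
  assumes "d > 1"
  shows "carrier (unit_group_mod d) = int ` totatives d"
proof -
  interpret residues "int d" "residue_ring (int d)"
    by unfold_locales (use assms in auto)
  have "x \<in> int ` totatives d" if "0 < x" "x < int d" "coprime x (int d)" for x
    using that by (intro image_eqI[of _ _ "nat x"]) (auto simp: in_totatives_iff coprime_int_iff[symmetric])
  then show ?thesis
    using assms by (auto simp: unit_group_mod_def units_of_carrier res_units_eq in_totatives_iff
        dest: totatives_less)
qed

lemma pow_unit_group_mod:
  fixes i :: nat
  assumes "d > 1" "x mod int d \<in> carrier (unit_group_mod d)"
  shows "(x mod int d) [^]\<^bsub>unit_group_mod d\<^esub> i = x ^ i mod int d"
proof -
  interpret residues "int d" "residue_ring (int d)"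
    by unfold_locales (use assms in auto)
  show ?thesis
    using assms(2) by (simp add: unit_group_mod_def units_of_carrier units_of_pow pow_cong)
qed

text \<open>The powers of a primitive root, reduced modulo \<open>d\<close>, exhaust the totatives,
  and they are the powers of its residue in the group.\<close>

lemma cyclic_unit_group_mod:
  assumes "d > 1" "residue_primroot d g"
  shows "cyclic_group (unit_group_mod d)"
proof -
  interpret group "unit_group_mod d"
    by (rule group_unit_group_mod[OF assms(1)])
  have img: "(\<lambda>i. g ^ i mod d) ` {..<totient d} = totatives d"
    using residue_primroot_is_generator[OF assms] by (simp add: bij_betw_def)
  have "g mod d \<in> totatives d"
    using assms by (auto simp: residue_primroot_def in_totatives_iff coprime_commute
        mod_greater_zero_iff_not_dvd dest: coprime_common_divisor)
  then have g: "int g mod int d \<in> carrier (unit_group_mod d)"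
    using assms(1) by (auto simp: carrier_unit_group_mod simp flip: zmod_int)
  have "y \<in> range (\<lambda>n::int. (int g mod int d) [^]\<^bsub>unit_group_mod d\<^esub> n)"
    if "y \<in> carrier (unit_group_mod d)" for y
  proof -
    have "y \<in> int ` (\<lambda>i. g ^ i mod d) ` {..<totient d}"
      using that assms(1) by (simp add: carrier_unit_group_mod img)
    then obtain i where "y = int g ^ i mod int d"
      by (auto simp: zmod_int)
    then have "y = (int g mod int d) [^]\<^bsub>unit_group_mod d\<^esub> int i"
      using pow_unit_group_mod[OF assms(1) g] by (simp add: int_pow_int)
    then show ?thesis by blast
  qed
  then show ?thesis
    unfolding cyclic_group using g by (intro bexI[of _ "int g mod int d"]) auto
qed

section \<open>Dedekind sums at elements of order \<open>p^n\<close>\<close>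

lemma dedekind_sum_elements_of_order:
  fixes p m n :: nat and h :: int
  assumes p: "prime p" "odd p" and n: "1 \<le> n" "2 * n \<le> m"
    and h: "h mod int (p ^ m) \<in> elements_of_order (unit_group_mod (p ^ m)) (p ^ n)"
  shows "dedekind_sum h (p ^ m) =
    (real (p ^ (m - n)))\<^sup>2 / (12 * real (p ^ m)) - 1 / 4 + 1 / (6 * real (p ^ m))"
proof -
  let ?G = "unit_group_mod (p ^ m)"
  have p1: "p > 1" and pm: "p ^ m > 1"
    using prime_gt_1_nat[OF p(1)] one_less_power[of p m] n by auto
  interpret group ?G
    by (rule group_unit_group_mod[OF pm])
  have hG: "h mod int (p ^ m) \<in> carrier ?G" and ord: "ord (h mod int (p ^ m)) = p ^ n"
    using h by (auto simp: elements_of_order_def)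
  have one: "\<one>\<^bsub>?G\<^esub> = 1"
    by (simp add: unit_group_mod_def units_of_def residue_ring_def)
  have "1 < int p ^ m"
    using pm by (metis of_nat_1 of_nat_less_iff of_nat_power)
  then have pow: "[h ^ i = 1] (mod int p ^ m) \<longleftrightarrow> p ^ n dvd i" for i
    using pow_eq_id[OF hG, of i] pm pow_unit_group_mod[OF pm hG, of i]
    by (simp add: ord[unfolded of_nat_power] one cong_def)
  have nm: "n < m"
    using n by simp
  have not_one: "\<not> [h ^ (p ^ (n - 1)) = 1] (mod int p ^ m)"
    unfolding pow using n p1 by (simp add: dvd_power_iff_le)
  have "[h ^ (p ^ n) = 1] (mod int p ^ m)"
    unfolding pow by simp
  then obtain k where k: "h = 1 + k * int p ^ (m - n)" "coprime k (int p)"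
    using not_one by (rule order_prime_power_imp_one_plus_mult[OF p n(1) nm])
  \<comment> \<open>The bound \<open>2 * n \<le> m\<close> is what makes the evaluation applicable
    with \<open>f = p^m\<close> and \<open>f' = p^(m - n)\<close>.\<close>
  have "p ^ m dvd (p ^ (m - n))\<^sup>2"
    using n by (simp add: le_imp_power_dvd flip: power_mult)
  moreover have "p ^ (m - n) dvd p ^ m"
    by (simp add: le_imp_power_dvd)
  moreover have "coprime k (int (p ^ m))"
    using k(2) by simp
  ultimately show ?thesis
    using dedekind_sum_one_plus_mult[of "p ^ m" "p ^ (m - n)" k] p1 pm k(1) by simp
qed

text \<open>Odd prime powers have primitive roots, and \<open>p^n\<close> divides the group order
  \<open>p^(m - 1) * (p - 1)\<close> because \<open>n \<le> m - 1\<close>.\<close>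

lemma unit_group_mod_odd_prime_power:
  assumes p: "prime p" "odd p" and n: "1 \<le> n" "n < m"
  shows "cyclic_group (unit_group_mod (p ^ m))"
    and "card (elements_of_order (unit_group_mod (p ^ m)) (p ^ n)) = totient (p ^ n)"
proof -
  have pm: "p ^ m > 1"
    using prime_gt_1_nat[OF p(1)] one_less_power[of p m] n by auto
  interpret group "unit_group_mod (p ^ m)"
    by (rule group_unit_group_mod[OF pm])
  obtain g where "\<forall>k>0. residue_primroot (p ^ k) g"
    using residue_primroot_odd_prime_power_exists[OF p] .
  then show cyclic: "cyclic_group (unit_group_mod (p ^ m))"
    using n by (intro cyclic_unit_group_mod[OF pm, of g]) auto
  have "order (unit_group_mod (p ^ m)) = totient (p ^ m)"
    using pm by (simp add: order_def carrier_unit_group_mod card_image totient_def)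
  also have "\<dots> = p ^ (m - 1) * (p - 1)"
    using p(1) n by (intro totient_prime_power) auto
  finally have "p ^ n dvd order (unit_group_mod (p ^ m))"
    using n by (auto intro!: dvd_mult2 le_imp_power_dvd)
  then show "card (elements_of_order (unit_group_mod (p ^ m)) (p ^ n)) = totient (p ^ n)"
    using cyclic pm by (intro card_elements_of_order_cyclic) (auto simp: carrier_unit_group_mod)
qed

theorem theorem5p6:
  shows
    "(\<forall>(f::nat) (f'::nat). f \<ge> 1 \<and> f' \<ge> 1 \<and> f dvd f'\<^sup>2 \<and> f' dvd f \<longrightarrow>
        (\<forall>k::int. gcd (1 + k * int f') (int f) = 1 \<and>
          (gcd k (int f) = 1 \<longrightarrow>
            dedekind_sum (1 + k * int f') f =
              (real f')\<^sup>2 / (12 * real f) - 1 / 4 + 1 / (6 * real f))))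
     \<and>
     (\<forall>(p::nat) (m::nat) (n::nat) (f::nat).
        prime p \<and> p \<ge> 3 \<and> f = p ^ m \<and> 1 \<le> n \<and> real n \<le> real m / 2 \<longrightarrow>
        (\<forall>k::int. 1 \<le> k \<and> k \<le> int (p ^ n) - 1 \<and> gcd k (int p) = 1 \<longrightarrow>
          dedekind_sum (1 + k * int (f div p ^ n)) f =
            real f / (12 * real p ^ (2 * n)) - 1 / 4 + 1 / (6 * real f)))
     \<and>
     (\<forall>(p::nat) (m::nat) (n::nat).
        prime p \<and> p \<ge> 3 \<and> m \<ge> 2 \<and> 1 \<le> n \<and> real n \<le> real m / 2 \<longrightarrow>
        group (unit_group_mod (p ^ m)) \<and>
        cyclic_group (unit_group_mod (p ^ m)) \<and>
        card (elements_of_order (unit_group_mod (p ^ m)) (p ^ n)) = totient (p ^ n) \<and>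
        totient (p ^ n) = p ^ (n - 1) * (p - 1) \<and>
        (\<exists>v::real. \<forall>h::int.
          h mod int (p ^ m) \<in> elements_of_order (unit_group_mod (p ^ m)) (p ^ n) \<longrightarrow>
          dedekind_sum h (p ^ m) = v))"
proof (intro conjI allI impI; (elim conjE)?)
  fix f f' :: nat and k :: int
  assume f: "f \<ge> 1" "f dvd f'\<^sup>2" "f' dvd f"
  then have "int f dvd (int f')\<^sup>2"
    by (metis of_nat_dvd_iff of_nat_power)
  then show "gcd (1 + k * int f') (int f) = 1"
    using coprime_one_plus_mult coprime_iff_gcd_eq_1 by blast
  assume "gcd k (int f) = 1"
  with f show "dedekind_sum (1 + k * int f') f =
      (real f')\<^sup>2 / (12 * real f) - 1 / 4 + 1 / (6 * real f)"
    by (intro dedekind_sum_one_plus_mult) (auto simp: coprime_iff_gcd_eq_1)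
next
  fix p m n f :: nat and k :: int
  assume p: "prime p" and f: "f = p ^ m" and n: "real n \<le> real m / 2" and k: "gcd k (int p) = 1"
  have nm: "2 * n \<le> m"
    using n by linarith
  have p0: "p > 0"
    using p by (rule prime_gt_0_nat)
  have div: "f div p ^ n = p ^ (m - n)"
    using nm p0 by (simp add: f power_diff)
  have "dedekind_sum (1 + k * int (p ^ (m - n))) f =
      (real (p ^ (m - n)))\<^sup>2 / (12 * real f) - 1 / 4 + 1 / (6 * real f)"
  proof (rule dedekind_sum_one_plus_mult)
    show "f > 0"
      using p0 by (simp add: f)
    show "f dvd (p ^ (m - n))\<^sup>2"
      using nm by (simp add: f le_imp_power_dvd flip: power_mult)
    show "p ^ (m - n) dvd f"
      by (simp add: f le_imp_power_dvd)
    show "coprime k (int f)"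
      using k by (simp add: f flip: coprime_iff_gcd_eq_1)
  qed
  \<comment> \<open>Here \<open>f' = f / p^n\<close>, so \<open>f'^2 / f\<close> becomes
    \<open>f / p^(2 * n)\<close>.\<close>
  moreover have "(real (p ^ (m - n)))\<^sup>2 / (12 * real f) = real f / (12 * real p ^ (2 * n))"
  proof -
    have "real (p ^ (m - n)) * real p ^ n = real f"
      using nm by (simp add: f flip: power_add)
    then have "(real (p ^ (m - n)))\<^sup>2 * real p ^ (2 * n) = (real f)\<^sup>2"
      by (metis power_even_eq power_mult_distrib)
    then show ?thesis
      using p0 by (simp add: f field_simps power2_eq_square)
  qed
  ultimately show "dedekind_sum (1 + k * int (f div p ^ n)) f =
      real f / (12 * real p ^ (2 * n)) - 1 / 4 + 1 / (6 * real f)"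
    by (simp only: div)
next
  fix p m n :: nat
  assume p: "prime p" "p \<ge> 3" and n: "1 \<le> n" "real n \<le> real m / 2"
  have odd: "odd p"
    using p by (intro prime_odd_nat) auto
  have nm: "2 * n \<le> m" "n < m"
    using n by linarith+
  have "p ^ m > 1"
    using one_less_power[of p m] p nm by auto
  then show "group (unit_group_mod (p ^ m))"
    by (rule group_unit_group_mod)
  show "cyclic_group (unit_group_mod (p ^ m))"
    using p(1) odd n(1) nm(2) by (rule unit_group_mod_odd_prime_power)
  show "card (elements_of_order (unit_group_mod (p ^ m)) (p ^ n)) = totient (p ^ n)"
    using p(1) odd n(1) nm(2) by (rule unit_group_mod_odd_prime_power)
  show "totient (p ^ n) = p ^ (n - 1) * (p - 1)"
    using p(1) n(1) by (intro totient_prime_power) auto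
  \<comment> \<open>The witness is the value from the evaluation, which depends on \<open>p\<close>,
    \<open>m\<close> and \<open>n\<close> but not on \<open>h\<close>.\<close>
  show "\<exists>v::real. \<forall>h::int.
      h mod int (p ^ m) \<in> elements_of_order (unit_group_mod (p ^ m)) (p ^ n) \<longrightarrow>
      dedekind_sum h (p ^ m) = v"
    using dedekind_sum_elements_of_order[OF p(1) odd n(1) nm(1)] by blast
qed

end
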